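(* Let $r \geq 2$ be an integer. Let $m \geq 2$ and let $A=\{a_1, a_2, \dots, a_m\}$ be a set of integers with $a_1 < a_2 < \cdots < a_m$. Set $$d=\gcd(a_2-a_1, a_3-a_1, \dots, a_m-a_1).$$ The following statements are equivalent. 1. $A$ is an asymptotic $(r,r)$-approximate group. 2. $A$ is an asymptotic arithmetic progression. 3. $a_2=a_1+d$ and $a_m=a_{m-1}+d$.
   Context: For nonempty sets $S,T$ of integers, $S+T=\{s+t \mid s\in S,\ t\in T\}$. For a positive integer $h$ and a nonempty set $A$ of integers, the $h$-fold sumset is $hA=\{x_1+\cdots+x_h \mid x_i\in A \text{ for } i=1,\dots,h\}$ (repetitions allowed). For positive integers $r$ and $l$, a nonempty finite set $A$ of integers is an $(r,l)$-approximate group if there exists a set $X$ consisting of $l$ integers such that $rA \subseteq A+X$. The set $A$ is an asymptotic $(r,l)$-approximate group if there is an integer $h_0$ such that $hA$ is an $(r,l)$-approximate group for every positive integer $h\geq h_0$. An arithmetic progression is a set of the form $\{a+i\delta \mid i=0,1,\dots,n-1\}$ for integers $a$, $\delta>0$, $n>0$. A set $A$ of integers is an asymptotic arithmetic progression if $hA$ is an arithmetic progression for all sufficiently large positive integers $h$. *)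

theory Defs
  imports Complex_Main "HOL-Library.Set_Algebras"
begin

text \<open>Sumsets of two sets of integers are the library's elementwise sum
  \<open>S + T\<close> from Set_Algebras.\<close>

definition hfold_sumset :: "nat \<Rightarrow> int set \<Rightarrow> int set" where
  "hfold_sumset h A = {(\<Sum>i\<in>{1..h}. x i) | x. \<forall>i\<in>{1..h}. x i \<in> A}"

definition approximate_group :: "nat \<Rightarrow> nat \<Rightarrow> int set \<Rightarrow> bool" where
  "approximate_group r l A \<longleftrightarrow>
     r > 0 \<and> l > 0 \<and> finite A \<and> A \<noteq> {} \<and>
     (\<exists>X :: int set. finite X \<and> card X = l \<and> hfold_sumset r A \<subseteq> A + X)"

definition asymptotic_approximate_group :: "nat \<Rightarrow> nat \<Rightarrow> int set \<Rightarrow> bool" where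
  "asymptotic_approximate_group r l A \<longleftrightarrow>
     (\<exists>h0 :: nat. \<forall>h \<ge> h0. h > 0 \<longrightarrow> approximate_group r l (hfold_sumset h A))"

definition arithmetic_progression :: "int set \<Rightarrow> bool" where
  "arithmetic_progression S \<longleftrightarrow>
     (\<exists>(a :: int) (\<delta> :: int) (n :: nat).
        \<delta> > 0 \<and> n > 0 \<and> S = {a + int i * \<delta> | i :: nat. i < n})"

definition asymptotic_arithmetic_progression :: "int set \<Rightarrow> bool" where
  "asymptotic_arithmetic_progression A \<longleftrightarrow>
     (\<exists>h0 :: nat. \<forall>h \<ge> h0. h > 0 \<longrightarrow> arithmetic_progression (hfold_sumset h A))"

end

theory Submission
  imports Defs
begin

text \<open>
  Write \<open>A = {c + d x | x \<in> B}\<close> with \<open>c = a 1\<close>, so that \<open>B \<subseteq> {0..n}\<close> contains \<open>0\<close> and \<open>n\<close>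
  and has greatest common divisor 1. Sumsets commute with affine maps, so everything can be
  read off from \<open>hB\<close>, and the condition on the two extreme gaps of \<open>A\<close> says that \<open>1\<close> and \<open>n - 1\<close>
  lie in \<open>B\<close>. The three conditions are equivalent by a cycle of implications.

  \<^item> From approximate groups to gaps. Since every residue class modulo \<open>n\<close> is represented in some \<open>LB\<close>, there is a
    constant \<open>C\<close> such that \<open>hB\<close> contains all of \<open>{C..hn - C}\<close>, whatever \<open>h\<close> is
    (\<open>hfold_sumset_contains_interval\<close>). If \<open>1 \<notin> B\<close>, then \<open>1 \<notin> hB\<close>, so every translate of \<open>hB\<close>
    has a hole just above its left end. The set \<open>rhB\<close> reaches from \<open>0\<close> to \<open>r(hn)\<close>, and each
    translate spans only \<open>hn\<close>; \<open>r\<close> translates that have to overlap in order to fill one another's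
    holes are too short to reach that far (\<open>translates_with_hole_do_not_cover\<close>). Hence
    \<open>1 \<in> B\<close>. The same argument for the reflected set \<open>n - B\<close> gives \<open>n - 1 \<in> B\<close>.

  \<^item> From gaps to progressions. The elements \<open>0, 1, n - 1, n\<close> of \<open>B\<close> suffice to make \<open>hB\<close> the full interval
    \<open>{0..hn}\<close> as soon as \<open>h \<ge> 2n\<close> (\<open>hfold_sumset_eq_interval\<close>).

  \<^item> From progressions to approximate groups. The \<open>r\<close>-fold sumset of a progression with \<open>N\<close> terms is a progression with the
    same difference and \<open>r(N - 1) + 1 \<le> rN\<close> terms, so \<open>r\<close> consecutive copies cover it
    (\<open>arithmetic_progression_imp_approximate_group\<close>).
\<close>

section \<open>Elementary properties of sumsets\<close>

lemma hfold_sumset_0: "hfold_sumset 0 A = {0}"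
  by (simp add: hfold_sumset_def)

lemma hfold_sumset_Suc: "hfold_sumset (Suc h) A = hfold_sumset h A + A"
proof (intro set_eqI iffI)
  fix s assume "s \<in> hfold_sumset (Suc h) A"
  then obtain x where x: "s = (\<Sum>i\<in>{1..Suc h}. x i)" "\<forall>i\<in>{1..Suc h}. x i \<in> A"
    unfolding hfold_sumset_def by blast
  have "s = (\<Sum>i\<in>{1..h}. x i) + x (Suc h)"
    using x(1) by simp
  moreover have "(\<Sum>i\<in>{1..h}. x i) \<in> hfold_sumset h A"
    unfolding hfold_sumset_def using x(2) by auto
  moreover have "x (Suc h) \<in> A"
    using x(2) by simp
  ultimately show "s \<in> hfold_sumset h A + A"
    by (simp add: set_plus_intro)
next
  fix s assume "s \<in> hfold_sumset h A + A"
  then obtain x y where x: "s = (\<Sum>i\<in>{1..h}. x i) + y" "\<forall>i\<in>{1..h}. x i \<in> A" "y \<in> A"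
    unfolding hfold_sumset_def by (auto elim!: set_plus_elim)
  define z where "z = x(Suc h := y)"
  have "(\<Sum>i\<in>{1..h}. z i) = (\<Sum>i\<in>{1..h}. x i)"
    unfolding z_def by (intro sum.cong) auto
  then have "s = (\<Sum>i\<in>{1..Suc h}. z i)"
    using x(1) by (simp add: z_def)
  moreover have "\<forall>i\<in>{1..Suc h}. z i \<in> A"
    using x by (auto simp: z_def le_Suc_eq)
  ultimately show "s \<in> hfold_sumset (Suc h) A"
    unfolding hfold_sumset_def by blast
qed

lemma hfold_sumset_add: "hfold_sumset (h + k) A = hfold_sumset h A + hfold_sumset k A"
  by (induction k) (simp_all only: hfold_sumset_0 hfold_sumset_Suc add_0_right add_Suc_right add.assoc flip: set_zero)

lemma hfold_sumset_addI:
  "s \<in> hfold_sumset h A \<Longrightarrow> t \<in> hfold_sumset k A \<Longrightarrow> s + t \<in> hfold_sumset (h + k) A"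
  by (simp add: hfold_sumset_add set_plus_intro)

lemma hfold_sumset_hfold_sumset:
  "hfold_sumset r (hfold_sumset h A) = hfold_sumset (r * h) A"
  by (induction r)
    (simp_all only: hfold_sumset_0 hfold_sumset_Suc hfold_sumset_add mult_0 mult_Suc add.commute)

lemma hfold_sumset_multiple:
  assumes "x \<in> A"
  shows "int h * x \<in> hfold_sumset h A"
proof (induction h)
  case 0
  then show ?case by (simp add: hfold_sumset_0)
next
  case (Suc h)
  then have "int h * x + x \<in> hfold_sumset (Suc h) A"
    unfolding hfold_sumset_Suc using assms by (rule set_plus_intro)
  then show ?case by (simp add: algebra_simps)
qed

lemma hfold_sumset_mono_count:
  assumes "0 \<in> A" "h \<le> k"
  shows "hfold_sumset h A \<subseteq> hfold_sumset k A"
proof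
  fix s assume "s \<in> hfold_sumset h A"
  then have "s + int (k - h) * 0 \<in> hfold_sumset (h + (k - h)) A"
    using assms(1) by (intro hfold_sumset_addI hfold_sumset_multiple)
  then show "s \<in> hfold_sumset k A"
    using assms(2) by simp
qed

text \<open>The parameter \<open>d\<close> may be negative. This lets a fact about the left end of \<open>B\<close> be transferred to
  the right end, by writing the same set \<open>A\<close> as an affine image of \<open>n - B\<close>.\<close>

lemma hfold_sumset_affine:
  "hfold_sumset h ((\<lambda>x. c + d * x) ` B) = (\<lambda>x. int h * c + d * x) ` hfold_sumset h B"
proof (induction h)
  case 0
  then show ?case by (simp add: hfold_sumset_0)
next
  case (Suc h)
  have "hfold_sumset (Suc h) ((\<lambda>x. c + d * x) ` B)
      = {(int h * c + d * s) + (c + d * b) | s b. s \<in> hfold_sumset h B \<and> b \<in> B}"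
    unfolding hfold_sumset_Suc Suc.IH by (auto simp: set_plus_def)
  also have "\<dots> = {int (Suc h) * c + d * (s + b) | s b. s \<in> hfold_sumset h B \<and> b \<in> B}"
    by (simp add: algebra_simps)
  also have "\<dots> = (\<lambda>x. int (Suc h) * c + d * x) ` hfold_sumset (Suc h) B"
    unfolding hfold_sumset_Suc by (auto simp: set_plus_def)
  finally show ?case .
qed

lemma hfold_sumset_bounds:
  assumes "B \<subseteq> {0..n}"
  shows "hfold_sumset h B \<subseteq> {0..int h * n}"
proof (induction h)
  case 0
  then show ?case by (simp add: hfold_sumset_0)
next
  case (Suc h)
  show ?case
  proof
    fix s assume "s \<in> hfold_sumset (Suc h) B"
    then obtain u b where "s = u + b" "u \<in> hfold_sumset h B" "b \<in> B"
      unfolding hfold_sumset_Suc by (rule set_plus_elim)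
    then have "0 \<le> u" "u \<le> int h * n" "0 \<le> b" "b \<le> n" "s = u + b"
      using Suc.IH assms by auto
    then show "s \<in> {0..int (Suc h) * n}"
      by (simp add: algebra_simps)
  qed
qed

text \<open>In a sum of nonnegative integers that equals 1, some summand is 1. So a set \<open>B\<close> that misses 1
  passes this hole on to all its sumsets.\<close>

lemma one_mem_of_one_mem_hfold_sumset:
  assumes "B \<subseteq> {0..n}" "1 \<in> hfold_sumset h B"
  shows "1 \<in> B"
  using assms(2)
proof (induction h)
  case 0
  then show ?case by (simp add: hfold_sumset_0)
next
  case (Suc h)
  from Suc.prems obtain u b where ub: "1 = u + b" "u \<in> hfold_sumset h B" "b \<in> B"
    unfolding hfold_sumset_Suc by (rule set_plus_elim)
  then have "0 \<le> u" "0 \<le> b"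
    using hfold_sumset_bounds[OF assms(1), of h] assms(1) by auto
  with ub(1) have "u = 1 \<or> b = 1"
    by linarith
  then show ?case
    using ub Suc.IH by blast
qed

section \<open>Large sumsets contain a long interval\<close>

text \<open>The residues modulo \<open>n\<close> that are represented by sums of elements of \<open>B\<close>, with any number of
  summands, are closed under addition. As \<open>n\<close> is positive, a multiple by any integer
  may be replaced by one by a natural number, so they form an ideal. By Bezout's identity the
  ideal contains the greatest common divisor of any finitely many elements of \<open>B\<close>.\<close>

lemma hfold_sumset_meets_Gcd_class:
  assumes n: "n > 0" and F: "finite F" "F \<subseteq> B"
  shows "\<exists>h. \<exists>e \<in> hfold_sumset h B. e mod n = (u * Gcd F) mod n"
proof -
  define P where "P t \<longleftrightarrow> (\<exists>h. \<exists>e \<in> hfold_sumset h B. e mod n = t mod n)" for t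
  have P_add: "P (s + t)" if "P s" "P t" for s t
  proof -
    from that obtain h k e f where
      "e \<in> hfold_sumset h B" "e mod n = s mod n" "f \<in> hfold_sumset k B" "f mod n = t mod n"
      unfolding P_def by blast
    then have "e + f \<in> hfold_sumset (h + k) B" "(e + f) mod n = (s + t) mod n"
      by (auto intro: hfold_sumset_addI mod_add_cong)
    then show ?thesis
      unfolding P_def by blast
  qed
  have P_0: "P 0"
    unfolding P_def by (rule exI[of _ 0]) (simp add: hfold_sumset_0)
  have P_nat: "P (int k * t)" if "P t" for k t
  proof (induction k)
    case 0
    then show ?case using P_0 by simp
  next
    case (Suc k)
    then have "P (t + int k * t)"
      using P_add that by blast
    then show ?case by (simp add: distrib_right)
  qed
  have P_int: "P (v * t)" if "P t" for v t
  proof -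
    have "P (int (nat (v mod n)) * t)"
      using that by (rule P_nat)
    moreover have "int (nat (v mod n)) * t mod n = v * t mod n"
      using n by (simp add: mod_mult_left_eq)
    ultimately show ?thesis
      unfolding P_def by simp
  qed
  have "P (Gcd F)"
    using F
  proof (induction F rule: finite_induct)
    case empty
    show ?case using P_0 by simp
  next
    case (insert b F)
    obtain v w where "v * b + w * Gcd F = gcd b (Gcd F)"
      using bezout_int by blast
    moreover have "P b"
      unfolding P_def
      using hfold_sumset_multiple[of b B 1] insert.prems by (intro exI[of _ 1]) auto
    ultimately show ?case
      using P_add[OF P_int P_int, of b "Gcd F" v w] insert by simp
  qed
  then show ?thesis
    using P_int unfolding P_def by blast
qed

text \<open>Fix \<open>L\<close> such that every residue class modulo \<open>n\<close> has a representative \<open>e \<in> LB\<close>; then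
  \<open>0 \<le> e \<le> Ln\<close>. An integer \<open>t\<close> between \<open>Ln\<close> and \<open>hn - Ln\<close> is such an \<open>e\<close> plus \<open>j\<close> copies of \<open>n\<close>
  with \<open>0 \<le> j \<le> h - L\<close>, and the remaining summands can be taken to be 0. So \<open>C = Ln\<close> works. That
  \<open>C\<close> does not depend on \<open>h\<close> is what the covering argument below relies on.\<close>

lemma hfold_sumset_contains_interval:
  assumes B: "B \<subseteq> {0..n}" "0 \<in> B" "n \<in> B" "Gcd B = 1" and n: "n > 0"
  obtains C where "C \<ge> 0" "\<And>h. {C..int h * n - C} \<subseteq> hfold_sumset h B"
proof -
  have fin: "finite B"
    using B(1) finite_subset by blast
  have "\<exists>h. \<exists>e \<in> hfold_sumset h B. e mod n = i mod n" for i
    using hfold_sumset_meets_Gcd_class[OF n fin subset_refl, of i] B(4) by simp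
  then obtain g where g: "\<And>i. \<exists>e \<in> hfold_sumset (g i) B. e mod n = i mod n"
    by metis
  define L where "L = Max (g ` {0..n})"
  have L: "\<exists>e \<in> hfold_sumset L B. e mod n = t mod n" for t
  proof -
    have "t mod n \<in> {0..n}"
      using n by (simp add: order_less_imp_le)
    then have "g (t mod n) \<le> L"
      unfolding L_def by (intro Max_ge) auto
    then show ?thesis
      using g[of "t mod n"] hfold_sumset_mono_count[OF B(2)] by fastforce
  qed
  show thesis
  proof (rule that[of "int L * n"])
    show "int L * n \<ge> 0"
      using n by simp
    fix h
    show "{int L * n..int h * n - int L * n} \<subseteq> hfold_sumset h B"
    proof
      fix t assume t: "t \<in> {int L * n..int h * n - int L * n}"
      obtain e where e: "e \<in> hfold_sumset L B" "e mod n = t mod n"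
        using L by blast
      have e_bounds: "0 \<le> e" "e \<le> int L * n"
        using hfold_sumset_bounds[OF B(1)] e(1) by fastforce+
      obtain j where j: "t - e = n * j"
        using e(2) by (metis mod_eq_dvd_iff dvd_def)
      have "0 \<le> n * j" "n * j \<le> n * (int h - int L)"
        using t e_bounds j by (auto simp: algebra_simps)
      then have "0 \<le> j" "j \<le> int h - int L"
        using n by (simp_all add: zero_le_mult_iff)
      then have "L + nat j \<le> h"
        by linarith
      have "e + int (nat j) * n \<in> hfold_sumset (L + nat j) B"
        using e(1) B(3) by (intro hfold_sumset_addI hfold_sumset_multiple)
      moreover have "e + int (nat j) * n = t"
        using j \<open>0 \<le> j\<close> by (simp add: algebra_simps)
      ultimately show "t \<in> hfold_sumset h B"
        using hfold_sumset_mono_count[OF B(2) \<open>L + nat j \<le> h\<close>] by auto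
    qed
  qed
qed

section \<open>Covering a long interval by translates with a hole\<close>

text \<open>The set \<open>T\<close> stands for \<open>rhB\<close> and \<open>S\<close> for \<open>hB\<close>, with \<open>M = hn\<close>.

  Consider the \<open>r\<close> test points \<open>q k = C + k (M + 2)\<close>. All of them lie in \<open>T\<close>, because \<open>M\<close> is large,
  and no translate \<open>x + {0..M}\<close> contains two of them. So the translates correspond to the test
  points, and they can be listed as \<open>x 0 < x 1 < \<dots> < x (r - 1)\<close> with \<open>q k\<close> in the \<open>k\<close>-th one.
  The test points are \<open>M + 2\<close> apart, rather than \<open>M + 1\<close>, so that consecutive \<open>x k\<close> differ by at
  least 2: the point \<open>x (k + 1) + 1\<close>, where the translate starting at \<open>x (k + 1)\<close> has its hole, is
  then not covered by a later translate either. It must be covered by an earlier one, which gives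
  \<open>x (k + 1) + 1 \<le> x k + M\<close>. Since \<open>0 \<in> T\<close> forces \<open>x 0 \<le> 0\<close>, it follows that
  \<open>x (r - 1) \<le> (r - 1)(M - 1)\<close>, whereas \<open>rM \<in> T\<close> forces \<open>x (r - 1) \<ge> (r - 1)M\<close>.\<close>

lemma translates_with_hole_do_not_cover:
  fixes r :: nat and C M :: int
  assumes r: "r \<ge> 2" and C: "C \<ge> 0"
    and S: "S \<subseteq> {0..M}" "1 \<notin> S"
    and T: "0 \<in> T" "int r * M \<in> T" "{C..int r * M - C} \<subseteq> T"
    and X: "finite X" "card X \<le> r"
    and M: "M \<ge> 2 * C + 2 * int r + 1"
  shows "\<not> T \<subseteq> S + X"
proof
  assume cover: "T \<subseteq> S + X"
  have coverD: "\<exists>x\<in>X. x \<le> t \<and> t \<le> x + M \<and> t \<noteq> x + 1" if "t \<in> T" for t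
  proof -
    from that cover obtain s x where "t = s + x" "s \<in> S" "x \<in> X"
      by (blast elim: set_plus_elim)
    then show ?thesis
      using S by (intro bexI[of _ x]) auto
  qed
  define q where "q k = C + int k * (M + 2)" for k
  have q_Suc: "q j \<ge> q i + (M + 2)" if "i < j" for i j
  proof -
    have "(int i + 1) * (M + 2) \<le> int j * (M + 2)"
      using that C M by (intro mult_right_mono) auto
    then show ?thesis
      by (simp add: q_def algebra_simps)
  qed
  have q_ge: "q k \<ge> C" for k
    using C M by (simp add: q_def)
  have q_last: "q (r - 1) = int r * M + C + 2 * int r - M - 2"
    using r by (simp add: q_def of_nat_diff algebra_simps)
  have q_le: "q k \<le> int r * M - C - 1" if "k < r" for k
  proof -
    have "q k \<le> q (r - 1)"
    proof (cases "k = r - 1")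
      case False
      then have "k < r - 1"
        using that by linarith
      then show ?thesis
        using q_Suc[of k "r - 1"] C M by linarith
    qed simp
    then show ?thesis
      using q_last M C by linarith
  qed
  have "\<exists>x\<in>X. x \<le> q k \<and> q k \<le> x + M" if "k < r" for k
    using coverD[of "q k"] T(3) q_ge[of k] q_le[OF that] by fastforce
  then obtain x where xX: "\<And>k. k < r \<Longrightarrow> x k \<in> X"
    and x: "\<And>k. k < r \<Longrightarrow> x k \<le> q k" "\<And>k. k < r \<Longrightarrow> q k \<le> x k + M"
    by metis
  have x_less: "x i + 2 \<le> x j" if "i < j" "j < r" for i j
    using q_Suc[OF that(1)] x(1)[of i] x(2)[of j] that by linarith
  have "inj_on x {..<r}"
    using x_less by (intro linorder_inj_onI') fastforce
  then have X_eq: "x ` {..<r} = X"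
    using X xX by (intro card_seteq) (auto simp: card_image)
  have coverD': "\<exists>j<r. x j \<le> t \<and> t \<le> x j + M \<and> t \<noteq> x j + 1" if "t \<in> T" for t
    using coverD[OF that] unfolding X_eq[symmetric] by auto
  have x_0: "x 0 \<le> 0"
  proof -
    obtain j where "j < r" "x j \<le> 0"
      using coverD'[OF T(1)] by blast
    then show ?thesis
      using x_less[of 0 j] by (cases "j = 0") auto
  qed
  have x_last: "x (r - 1) \<ge> int r * M - M"
  proof -
    obtain j where "j < r" "int r * M \<le> x j + M"
      using coverD'[OF T(2)] by blast
    then show ?thesis
    proof (cases "j = r - 1")
      case False
      then have "j < r - 1" "r - 1 < r"
        using \<open>j < r\<close> by linarith+
      then show ?thesis
        using x_less[of j "r - 1"] \<open>int r * M \<le> x j + M\<close> by linarith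
    qed (use \<open>int r * M \<le> x j + M\<close> in simp)
  qed
  have step: "x (Suc k) \<le> x k + (M - 1)" if k: "Suc k < r" for k
  proof -
    have "C \<le> x (Suc k) + 1" "x (Suc k) + 1 \<le> int r * M - C"
      using x[OF k] q_le[OF k] q_ge[of k] q_Suc[of k "Suc k"] by auto
    then have "x (Suc k) + 1 \<in> T"
      using T(3) by auto
    then obtain j where j: "j < r" "x j \<le> x (Suc k) + 1" "x (Suc k) + 1 \<le> x j + M" "x j \<noteq> x (Suc k)"
      using coverD' by fastforce
    have "\<not> Suc k < j"
      using x_less[of "Suc k" j] j by auto
    moreover have "j \<noteq> Suc k"
      using j(4) by auto
    ultimately have "j = k \<or> j < k"
      by auto
    then have "x j \<le> x k"
      using x_less[of j k] k by auto
    then show ?thesis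
      using j(3) by linarith
  qed
  have "x k \<le> int k * (M - 1)" if "k < r" for k
    using that
  proof (induction k)
    case 0
    then show ?case using x_0 by simp
  next
    case (Suc k)
    then show ?case using step[of k] by (simp add: algebra_simps)
  qed
  from this[of "r - 1"] have "x (r - 1) \<le> (int r - 1) * (M - 1)"
    using r by (simp add: of_nat_diff)
  also have "\<dots> < int r * M - M"
    using r by (simp add: algebra_simps)
  finally show False
    using x_last by simp
qed

text \<open>A cover of \<open>rhA\<close> by \<open>r\<close> translates of \<open>hA\<close> becomes one of \<open>rhB\<close> by at most \<open>r\<close> translates of
  \<open>hB\<close>, to which the preceding lemma applies for large \<open>h\<close>.\<close>

lemma one_mem_of_asymptotic_approximate_group:
  assumes r: "r \<ge> 2" and d: "d \<noteq> 0"
    and B: "B \<subseteq> {0..n}" "0 \<in> B" "n \<in> B" "Gcd B = 1" and n: "n > 0"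
    and approx: "asymptotic_approximate_group r r ((\<lambda>x. c + d * x) ` B)"
  shows "1 \<in> B"
proof (rule ccontr)
  assume "1 \<notin> B"
  obtain C where C: "C \<ge> 0" "\<And>h. {C..int h * n - C} \<subseteq> hfold_sumset h B"
    using hfold_sumset_contains_interval[OF B n] by blast
  obtain h0 where h0: "\<And>h. h \<ge> h0 \<Longrightarrow> h > 0 \<Longrightarrow>
      approximate_group r r (hfold_sumset h ((\<lambda>x. c + d * x) ` B))"
    using approx unfolding asymptotic_approximate_group_def by blast
  define h where "h = max h0 (nat (2 * C + 2 * int r + 1))"
  have h_large: "int h \<ge> 2 * C + 2 * int r + 1" and "h > 0"
    using C(1) by (auto simp: h_def)
  then have "approximate_group r r (hfold_sumset h ((\<lambda>x. c + d * x) ` B))"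
    by (intro h0) (auto simp: h_def)
  then obtain X where X: "finite X" "card X = r"
    "hfold_sumset (r * h) ((\<lambda>x. c + d * x) ` B) \<subseteq> hfold_sumset h ((\<lambda>x. c + d * x) ` B) + X"
    unfolding approximate_group_def hfold_sumset_hfold_sumset by blast
  \<comment> \<open>The quotient is exact for those elements of \<open>X\<close> whose translate meets \<open>rhA\<close>; the others
      yield further elements of \<open>Y\<close>, which do no harm.\<close>
  define Y where "Y = (\<lambda>x. (x + int h * c - int (r * h) * c) div d) ` X"
  have cover: "hfold_sumset (r * h) B \<subseteq> hfold_sumset h B + Y"
  proof
    fix t assume "t \<in> hfold_sumset (r * h) B"
    then have "int (r * h) * c + d * t \<in> hfold_sumset h ((\<lambda>x. c + d * x) ` B) + X"
      using X(3) unfolding hfold_sumset_affine by auto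
    then obtain s x where s: "s \<in> hfold_sumset h B" "x \<in> X"
      "int (r * h) * c + d * t = int h * c + d * s + x"
      unfolding hfold_sumset_affine by (auto elim!: set_plus_elim)
    then have "x + int h * c - int (r * h) * c = d * (t - s)"
      by (simp add: algebra_simps)
    then have "t - s \<in> Y"
      unfolding Y_def using d s(2) by (intro image_eqI[of _ _ x]) auto
    then have "s + (t - s) \<in> hfold_sumset h B + Y"
      using s(1) by (intro set_plus_intro)
    then show "t \<in> hfold_sumset h B + Y"
      by simp
  qed
  have "\<not> hfold_sumset (r * h) B \<subseteq> hfold_sumset h B + Y"
  proof (rule translates_with_hole_do_not_cover[OF r C(1)])
    show "hfold_sumset h B \<subseteq> {0..int h * n}"
      by (rule hfold_sumset_bounds[OF B(1)])
    show "1 \<notin> hfold_sumset h B"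
      using one_mem_of_one_mem_hfold_sumset[OF B(1)] \<open>1 \<notin> B\<close> by blast
    show "0 \<in> hfold_sumset (r * h) B"
      using hfold_sumset_multiple[OF B(2)] by simp
    show "int r * (int h * n) \<in> hfold_sumset (r * h) B"
      using hfold_sumset_multiple[OF B(3), of "r * h"] by (simp add: mult.assoc)
    show "{C..int r * (int h * n) - C} \<subseteq> hfold_sumset (r * h) B"
      using C(2)[of "r * h"] by (simp add: mult.assoc)
    show "finite Y" "card Y \<le> r"
      unfolding Y_def using X(1,2) card_image_le by blast+
    have "int h * 1 \<le> int h * n"
      using n by (intro mult_left_mono) auto
    then show "2 * C + 2 * int r + 1 \<le> int h * n"
      using h_large by linarith
  qed
  with cover show False
    by blast
qed

section \<open>Sumsets and arithmetic progressions\<close>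

text \<open>Divide \<open>t\<close> by \<open>n\<close> with quotient \<open>j\<close> and remainder \<open>i\<close>. Then \<open>t\<close> is a sum of \<open>j\<close> copies of \<open>n\<close> and
  \<open>i\<close> copies of 1, which is good enough if \<open>i + j \<le> h\<close>. Otherwise \<open>j\<close> is so large that \<open>n - i\<close> of
  the summands \<open>n\<close>, counted from the next multiple \<open>(j + 1) n\<close> of \<open>n\<close>, can be lowered to \<open>n - 1\<close>;
  this takes only \<open>j + 1\<close> summands.\<close>

lemma hfold_sumset_eq_interval:
  assumes B: "B \<subseteq> {0..n}" "0 \<in> B" "1 \<in> B" "n - 1 \<in> B" "n \<in> B" and n: "n > 0"
    and h: "int h \<ge> 2 * n"
  shows "hfold_sumset h B = {0..int h * n}"
proof
  show "hfold_sumset h B \<subseteq> {0..int h * n}"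
    by (rule hfold_sumset_bounds[OF B(1)])
  have combine: "int j * n + int i * b \<in> hfold_sumset h B" if "b \<in> B" "i + j \<le> h" for i j b
  proof -
    have "int j * n + int i * b \<in> hfold_sumset (j + i) B"
      using that B(5) by (intro hfold_sumset_addI hfold_sumset_multiple)
    then show ?thesis
      using hfold_sumset_mono_count[OF B(2), of "j + i" h] that(2) by auto
  qed
  show "{0..int h * n} \<subseteq> hfold_sumset h B"
  proof
    fix t assume t: "t \<in> {0..int h * n}"
    define i j where "i = t mod n" and "j = t div n"
    have ij: "0 \<le> i" "i < n" "0 \<le> j" "t = j * n + i"
      using n t by (auto simp: i_def j_def pos_imp_zdiv_nonneg_iff)
    show "t \<in> hfold_sumset h B"
    proof (cases "i + j \<le> int h")
      case True
      then show ?thesis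
        using combine[OF B(3), of "nat i" "nat j"] ij by simp
    next
      case False
      show ?thesis
      proof (cases "i = 0")
        \<comment> \<open>Here \<open>j + 1\<close> summands could be too many, but \<open>t = jn \<le> hn\<close> excludes the case.\<close>
        case True
        have "j * n \<le> int h * n"
          using t ij True by simp
        then show ?thesis
          using False True n by simp
      next
        case i: False
        have "n - i + (j - (n - i) + 1) \<le> int h"
        proof -
          have "j * n + i \<le> int h * n"
            using t ij(4) by simp
          then have "j * n < int h * n"
            using ij(1) i by linarith
          then have "j < int h"
            using n by simp
          then show ?thesis by linarith
        qed
        moreover have "t = (j - (n - i) + 1) * n + (n - i) * (n - 1)"
          using ij(4) by (simp add: algebra_simps)
        ultimately show ?thesis
          using combine[OF B(4), of "nat (n - i)" "nat (j - (n - i) + 1)"] ij False h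
          by simp
      qed
    qed
  qed
qed

lemma asymptotic_arithmetic_progression_affine:
  assumes B: "B \<subseteq> {0..n}" "0 \<in> B" "1 \<in> B" "n - 1 \<in> B" "n \<in> B" and n: "n > 0"
    and d: "d > 0"
  shows "asymptotic_arithmetic_progression ((\<lambda>x. c + d * x) ` B)"
  unfolding asymptotic_arithmetic_progression_def
proof (intro exI[of _ "nat (2 * n)"] allI impI)
  fix h :: nat assume "h \<ge> nat (2 * n)" "h > 0"
  then have "hfold_sumset h B = {0..int h * n}"
    using B n by (intro hfold_sumset_eq_interval) auto
  also have "\<dots> = int ` {..<nat (int h * n + 1)}"
    by (auto simp: image_iff intro!: bexI[of _ "nat _"])
  finally have "hfold_sumset h ((\<lambda>x. c + d * x) ` B)
      = {int h * c + int i * d | i. i < nat (int h * n + 1)}"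
    unfolding hfold_sumset_affine by (auto simp: image_image mult.commute)
  moreover have "nat (int h * n + 1) > 0"
    using n by (simp add: add_nonneg_pos)
  ultimately show "arithmetic_progression (hfold_sumset h ((\<lambda>x. c + d * x) ` B))"
    unfolding arithmetic_progression_def using d by blast
qed

text \<open>With \<open>S\<close> an affine image of \<open>{0..N - 1}\<close>, its \<open>r\<close>-fold sumset is the affine image of a subset of
  \<open>{0..rN - 1}\<close>, which is cut into \<open>r\<close> blocks of length \<open>N\<close>.\<close>

lemma arithmetic_progression_imp_approximate_group:
  assumes "arithmetic_progression S" and r: "r > 0"
  shows "approximate_group r r S"
proof -
  obtain a \<delta> and N :: nat where ap: "\<delta> > 0" "N > 0" "S = {a + int i * \<delta> | i. i < N}"
    using assms(1) unfolding arithmetic_progression_def by blast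
  define X where "X = (\<lambda>k. int r * a - a + int k * (int N * \<delta>)) ` {..<r}"
  have S_eq: "S = (\<lambda>x. a + \<delta> * x) ` (int ` {..<N})"
    unfolding ap(3) by (auto simp: mult.commute)
  have "hfold_sumset r S \<subseteq> S + X"
  proof
    fix s assume "s \<in> hfold_sumset r S"
    then obtain t where t: "t \<in> hfold_sumset r (int ` {..<N})" "s = int r * a + \<delta> * t"
      unfolding S_eq hfold_sumset_affine by blast
    have "int ` {..<N} \<subseteq> {0..int N - 1}"
      by auto
    from hfold_sumset_bounds[OF this, of r] t(1)
    have t_bounds: "0 \<le> t" "t \<le> int r * (int N - 1)"
      by auto
    define u where "u = nat t"
    have "t \<le> int r * int N - int r"
      using t_bounds(2) by (simp add: algebra_simps)
    then have "int u < int (r * N)"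
      using t_bounds(1) r by (simp add: u_def)
    then have "u < r * N"
      by linarith
    then have "u div N < r"
      by (simp add: less_mult_imp_div_less)
    have "t = int (u mod N) + int (u div N) * int N"
      using t_bounds(1) by (simp add: u_def flip: of_nat_mult of_nat_add)
    then have "s = (a + int (u mod N) * \<delta>) + (int r * a - a + int (u div N) * (int N * \<delta>))"
      unfolding t(2) by (simp add: algebra_simps)
    moreover have "a + int (u mod N) * \<delta> \<in> S"
      unfolding ap(3) using ap(2) by auto
    moreover have "int r * a - a + int (u div N) * (int N * \<delta>) \<in> X"
      unfolding X_def using \<open>u div N < r\<close> by blast
    ultimately show "s \<in> S + X"
      by (metis set_plus_intro)
  qed
  moreover have "finite X" "card X = r"
    unfolding X_def using ap by (auto simp: card_image inj_on_def)
  moreover have "finite S" "S \<noteq> {}"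
    unfolding S_eq using ap(2) by auto
  ultimately show ?thesis
    unfolding approximate_group_def using r by blast
qed

section \<open>The three characterisations\<close>

text \<open>
  The theorem for the normalised set \<open>B\<close>. The right end of \<open>B\<close> is handled through the reflection
  \<open>B' = n - B\<close>, of which \<open>A\<close> is an affine image with slope \<open>-d\<close>.\<close>

lemma approximate_group_iff_progression_iff_ends:
  assumes r: "r \<ge> 2" and d: "d > 0"
    and B: "B \<subseteq> {0..n}" "0 \<in> B" "n \<in> B" "Gcd B = 1" and n: "n > 0"
    and A: "A = (\<lambda>x. c + d * x) ` B"
  shows "asymptotic_approximate_group r r A \<longleftrightarrow> asymptotic_arithmetic_progression A"
    and "asymptotic_arithmetic_progression A \<longleftrightarrow> 1 \<in> B \<and> n - 1 \<in> B"
proof -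
  have "1 \<in> B \<and> n - 1 \<in> B" if approx: "asymptotic_approximate_group r r A"
  proof
    show "1 \<in> B"
      using one_mem_of_asymptotic_approximate_group[OF r _ B n, of d c] d approx unfolding A by simp
    define B' where "B' = (\<lambda>x. n - x) ` B"
    have B': "B' \<subseteq> {0..n}" "0 \<in> B'" "n \<in> B'"
      using B by (auto simp: B'_def image_iff intro: bexI[of _ n] bexI[of _ 0])
    have "Gcd B' dvd b" if "b \<in> B" for b
    proof -
      have "Gcd B' dvd n" "Gcd B' dvd n - b"
        using B'(3) that by (auto simp: B'_def)
      then have "Gcd B' dvd n - (n - b)"
        by (rule dvd_diff)
      then show ?thesis by simp
    qed
    then have "Gcd B' dvd Gcd B"
      by (rule Gcd_greatest)
    then have gcd: "Gcd B' = 1"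
      using B(4) by simp
    have A': "A = (\<lambda>x. (c + d * n) + (- d) * x) ` B'"
      unfolding A B'_def by (auto simp: image_image algebra_simps)
    have "1 \<in> B'"
      using one_mem_of_asymptotic_approximate_group[OF r _ B' gcd n, of "- d" "c + d * n"]
        d approx A' by auto
    then obtain b where "b \<in> B" "1 = n - b"
      by (auto simp: B'_def)
    then show "n - 1 \<in> B"
      by (metis add_diff_cancel_left' add_diff_eq diff_diff_eq2)
  qed
  moreover have "asymptotic_arithmetic_progression A" if "1 \<in> B \<and> n - 1 \<in> B"
    unfolding A using that B n d by (intro asymptotic_arithmetic_progression_affine) auto
  moreover have "asymptotic_approximate_group r r A" if "asymptotic_arithmetic_progression A"
    using that r arithmetic_progression_imp_approximate_group
    unfolding asymptotic_arithmetic_progression_def asymptotic_approximate_group_def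
    by (meson less_le_trans pos2)
  ultimately show "asymptotic_approximate_group r r A \<longleftrightarrow> asymptotic_arithmetic_progression A"
    "asymptotic_arithmetic_progression A \<longleftrightarrow> 1 \<in> B \<and> n - 1 \<in> B"
    by blast+
qed

theorem theorem14:
  fixes r m :: nat and a :: "nat \<Rightarrow> int" and A :: "int set" and d :: int
  assumes "r \<ge> 2" and "m \<ge> 2"
    and "strict_mono_on {1..m} a"
    and "A = a ` {1..m}"
    and "d = Gcd ((\<lambda>i. a i - a 1) ` {2..m})"
  shows "(asymptotic_approximate_group r r A \<longleftrightarrow> asymptotic_arithmetic_progression A)
       \<and> (asymptotic_arithmetic_progression A \<longleftrightarrow> a 2 = a 1 + d \<and> a m = a (m - 1) + d)"
proof -
  have less: "a i < a j" if "1 \<le> i" "i < j" "j \<le> m" for i j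
    using strict_mono_onD[OF assms(3)] that by auto
  have le: "a i \<le> a j" if "1 \<le> i" "i \<le> j" "j \<le> m" for i j
    using less[of i j] that by (cases "i = j") auto
  have dvd: "d dvd a i - a 1" if "1 \<le> i" "i \<le> m" for i
    using that by (cases "i = 1") (auto simp: assms(5))
  have "a 1 < a 2"
    using less[of 1 2] assms(2) by auto
  moreover have "d dvd a 2 - a 1" "d \<ge> 0"
    using dvd[of 2] assms(2) by (auto simp: assms(5))
  ultimately have d: "d > 0"
    by (cases "d = 0") auto
  define b where "b i = (a i - a 1) div d" for i
  have a_eq: "a i = a 1 + d * b i" if "1 \<le> i" "i \<le> m" for i
    using dvd[OF that] by (simp add: b_def)
  define B where "B = b ` {1..m}"
  have A: "A = (\<lambda>x. a 1 + d * x) ` B"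
    unfolding assms(4) B_def image_image by (intro image_cong refl a_eq) simp_all
  have b_less: "b i < b j" if "1 \<le> i" "i < j" "j \<le> m" for i j
    using less[OF that] a_eq[of i] a_eq[of j] that d by auto
  have b_le: "b i \<le> b j" if "1 \<le> i" "i \<le> j" "j \<le> m" for i j
    using b_less[of i j] that by (cases "i = j") auto
  have b_1: "b 1 = 0"
    by (simp add: b_def)
  have B: "B \<subseteq> {0..b m}" "0 \<in> B" "b m \<in> B"
  proof -
    show "B \<subseteq> {0..b m}"
      using b_le[of 1] b_le[of _ m] b_1 by (auto simp: B_def)
    show "0 \<in> B" "b m \<in> B"
      using b_1 assms(2) unfolding B_def by (auto intro!: image_eqI[of _ b 1])
  qed
  have n: "b m > 0"
    using b_less[of 1 m] b_1 assms(2) by auto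
  have gcd: "Gcd B = 1"
  proof -
    have "d * Gcd B dvd a i - a 1" if "i \<in> {2..m}" for i
    proof -
      have "Gcd B dvd b i"
        using that by (auto simp: B_def)
      then show ?thesis
        using a_eq[of i] that by (auto intro: mult_dvd_mono)
    qed
    then have "d * Gcd B dvd d * 1"
      unfolding mult_1_right by (subst (2) assms(5)) (auto intro!: Gcd_greatest)
    then have "Gcd B dvd 1"
      using d by simp
    then show ?thesis by simp
  qed
  have "1 \<in> B \<longleftrightarrow> b 2 = 1"
  proof
    assume "1 \<in> B"
    then obtain i where i: "i \<in> {1..m}" "b i = 1"
      by (auto simp: B_def)
    then have "b 2 \<le> 1"
      using b_le[of 2 i] b_1 by (cases "i = 1") auto
    then show "b 2 = 1"
      using b_less[of 1 2] b_1 assms(2) by auto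
  next
    assume "b 2 = 1"
    then show "1 \<in> B"
      using assms(2) by (auto simp: B_def intro!: image_eqI[of _ b 2])
  qed
  also have "\<dots> \<longleftrightarrow> a 2 = a 1 + d"
    using a_eq[of 2] assms(2) d by auto
  finally have first: "1 \<in> B \<longleftrightarrow> a 2 = a 1 + d" .
  have "b m - 1 \<in> B \<longleftrightarrow> b m = b (m - 1) + 1"
  proof
    assume "b m - 1 \<in> B"
    then obtain i where i: "i \<in> {1..m}" "b i = b m - 1"
      by (auto simp: B_def)
    then have "b m - 1 \<le> b (m - 1)"
      using b_le[of i "m - 1"] by (cases "i = m") auto
    then show "b m = b (m - 1) + 1"
      using b_less[of "m - 1" m] assms(2) by force
  next
    assume "b m = b (m - 1) + 1"
    then show "b m - 1 \<in> B"
      using assms(2) by (auto simp: B_def intro!: image_eqI[of _ b "m - 1"])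
  qed
  also have "\<dots> \<longleftrightarrow> d * b m = d * (b (m - 1) + 1)"
    using d by simp
  also have "\<dots> \<longleftrightarrow> a m = a (m - 1) + d"
    using a_eq[of m] a_eq[of "m - 1"] assms(2) by (simp add: algebra_simps)
  finally have last: "b m - 1 \<in> B \<longleftrightarrow> a m = a (m - 1) + d" .
  show ?thesis
    using approximate_group_iff_progression_iff_ends[OF assms(1) d B gcd n A]
    unfolding first last by blast
qed

end
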